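(* Let $H$ be a separable Hilbert space, let $A\colon H\to H$ be a (bounded) normal operator, and let $S=\{x_i\}_{i=1}^N$ be a finite subset of $H$ such that $A^nx\neq 0$ for all $n\ge 0$ and $x\in S$. Assume that at least one of the following conditions holds. (a) $\{A^nx\}_{x\in S,\,n\ge 0}$ is a frame for $H$. (b) There exist constants $0<B\le C$ such that $B\le \|A^nx\|\le C$ for every $n\ge 0$ and every $x\in S$. (c) $\|A\|=1$ and $A$ has a nonzero fixed point $w_0$ for which $\langle w_0,x_i\rangle\neq 0$ for all $1\le i\le N$. (d) $\|A\|<1$ and there is an infinite-dimensional closed subspace $M$ of $H$ such that $\{P_MA^nx\}_{n\ge 0,\,x\in S}$ satisfies a lower frame condition in $M$. Then $\{A^nx\}_{x\in S,\,n\ge 0}$ is not frame-normalizable.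
   Context: All families are regarded as countable indexed families (repetitions counted); $\{A^nx\}_{x\in S,n\ge0}$ is indexed by the pairs $(x,n)$. A countable family $\{z_j\}$ in a separable Hilbert space $K$ is a frame for $K$ if there are constants $0<L\le L'$ with $L\|y\|^2\le\sum_j|\langle y,z_j\rangle|^2\le L'\|y\|^2$ for all $y\in K$; it satisfies a lower frame condition in $K$ if the left inequality holds for some $L>0$. A family $\{z_j\}$ of nonzero vectors is frame-normalizable if $\{z_j/\|z_j\|\}$ is a frame for the space. $P_M$ is the orthogonal projection of $H$ onto $M$. *)

theory Defs
  imports "HOL-Analysis.Analysis"
begin

section \<open>Complex Hilbert spaces\<close>

text \<open>
  Complex inner products extend the library's \<^class>\<open>real_inner\<close>: the norm is the one of the real
  inner product \<^term>\<open>Re (cinner x y)\<close>.  The complex inner product is linear in its first argument.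
\<close>

class complex_inner = real_inner +
  fixes scaleC :: "complex \<Rightarrow> 'a \<Rightarrow> 'a" (infixr "*\<^sub>C" 75)
    and cinner :: "'a \<Rightarrow> 'a \<Rightarrow> complex"
  assumes scaleC_add_right: "a *\<^sub>C (x + y) = a *\<^sub>C x + a *\<^sub>C y"
    and scaleC_add_left: "(a + b) *\<^sub>C x = a *\<^sub>C x + b *\<^sub>C x"
    and scaleC_scaleC: "a *\<^sub>C b *\<^sub>C x = (a * b) *\<^sub>C x"
    and scaleC_of_real: "complex_of_real r *\<^sub>C x = r *\<^sub>R x"
    and cinner_commute: "cinner x y = cnj (cinner y x)"
    and cinner_add_left: "cinner (x + y) z = cinner x z + cinner y z"
    and cinner_scaleC_left: "cinner (a *\<^sub>C x) y = a * cinner x y"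
    and Re_cinner: "Re (cinner x y) = x \<bullet> y"

class chilbert_space = complex_inner + complete_space

instantiation complex :: chilbert_space
begin
definition scaleC_complex :: "complex \<Rightarrow> complex \<Rightarrow> complex" where "scaleC_complex = (*)"
definition cinner_complex :: "complex \<Rightarrow> complex \<Rightarrow> complex" where "cinner_complex x y = x * cnj y"
instance
  by standard (auto simp: scaleC_complex_def cinner_complex_def algebra_simps scaleR_conv_of_real
      inner_complex_def)
end

global_interpretation complex_vector: vector_space "scaleC :: complex \<Rightarrow> 'a \<Rightarrow> 'a :: complex_inner"
  by unfold_locales (simp_all add: scaleC_add_right scaleC_add_left scaleC_scaleC
      scaleC_of_real[of 1, simplified])

lemma cinner_add_right: "cinner x (y + z) = cinner x y + cinner x (z :: 'a::complex_inner)"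
  by (metis cinner_add_left cinner_commute complex_cnj_add)

lemma cinner_scaleC_right: "cinner x (a *\<^sub>C y) = cnj a * cinner x (y :: 'a::complex_inner)"
  by (metis cinner_commute cinner_scaleC_left complex_cnj_mult)

lemma cinner_zero_left [simp]: "cinner 0 (y :: 'a::complex_inner) = 0"
  using cinner_add_left[of 0 0 y] by simp

lemma cinner_diff_left: "cinner (x - y) z = cinner x z - cinner y (z :: 'a::complex_inner)"
  using cinner_add_left[of "x - y" y z] by simp

lemma cinner_zero_right [simp]: "cinner x (0 :: 'a::complex_inner) = 0"
  using cinner_add_right[of x 0 0] by simp

lemma cinner_diff_right: "cinner x (y - z) = cinner x y - cinner x (z :: 'a::complex_inner)"
  using cinner_add_right[of x "y - z" z] by simp

lemma cinner_self: "cinner x (x :: 'a::complex_inner) = of_real ((norm x)\<^sup>2)"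
proof (rule complex_eqI)
  show "Im (cinner x x) = Im (of_real ((norm x)\<^sup>2))"
    using cinner_commute[of x x] by (metis Im_complex_of_real Reals_cnj_iff complex_is_Real_iff)
qed (simp add: Re_cinner power2_norm_eq_inner)

lemma cinner_ext: "x = y" if "\<And>z. cinner z x = cinner z (y :: 'a::complex_inner)"
proof -
  have "cinner (x - y) (x - y) = 0"
    using that[of "x - y"] by (simp add: cinner_diff_right)
  then show ?thesis by (simp add: cinner_self)
qed


section \<open>Orthogonal projections and normal operators\<close>

definition orth_proj :: "'a::complex_inner set \<Rightarrow> 'a \<Rightarrow> 'a" where
  "orth_proj M x = (THE p. p \<in> M \<and> (\<forall>m\<in>M. cinner (x - p) m = 0))"

definition bounded_clinear :: "('a::complex_inner \<Rightarrow> 'a) \<Rightarrow> bool" where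
  "bounded_clinear A \<longleftrightarrow> bounded_linear A \<and> (\<forall>c x. A (c *\<^sub>C x) = c *\<^sub>C A x)"

definition cadjoint :: "('a::complex_inner \<Rightarrow> 'a) \<Rightarrow> 'a \<Rightarrow> 'a" where
  "cadjoint A = (THE B. \<forall>x y. cinner (A x) y = cinner x (B y))"

definition normal_operator :: "('a::complex_inner \<Rightarrow> 'a) \<Rightarrow> bool" where
  "normal_operator A \<longleftrightarrow> bounded_clinear A \<and> A \<circ> cadjoint A = cadjoint A \<circ> A"

text \<open>
  The two definite descriptions above are well defined on a Hilbert space, by the projection theorem
  and the Riesz representation theorem.
\<close>

lemma orth_proj_ex:
  fixes M :: "'a::chilbert_space set"
  assumes M: "complex_vector.subspace M" "closed M"
  shows "\<exists>!p. p \<in> M \<and> (\<forall>m\<in>M. cinner (x - p) m = 0)"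
proof -
  have M0: "0 \<in> M" and Madd: "\<And>u v. u \<in> M \<Longrightarrow> v \<in> M \<Longrightarrow> u + v \<in> M"
    and Mscale: "\<And>c u. u \<in> M \<Longrightarrow> c *\<^sub>C u \<in> M" and Mdiff: "\<And>u v. u \<in> M \<Longrightarrow> v \<in> M \<Longrightarrow> u - v \<in> M"
    using M(1) complex_vector.subspace_0 complex_vector.subspace_add complex_vector.subspace_scale
      complex_vector.subspace_diff by blast+
  have MscaleR: "r *\<^sub>R u \<in> M" if "u \<in> M" for r u
    using Mscale[OF that, of "of_real r"] by (simp add: scaleC_of_real)
  define d where "d = infdist x M"
  have d_le: "d \<le> dist x m" if "m \<in> M" for m
    using that unfolding d_def by (rule infdist_le)
  have d0: "d \<ge> 0" unfolding d_def by (rule infdist_nonneg)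
  have "\<exists>m\<in>M. dist x m < d + 1 / real (Suc n)" for n
  proof (rule ccontr)
    assume "\<not> ?thesis"
    then have "d + 1 / real (Suc n) \<le> dist x m" if "m \<in> M" for m
      using that by (auto simp: not_less)
    then have "d + 1 / real (Suc n) \<le> infdist x M"
      using M0 by (auto simp: infdist_def intro!: cINF_greatest)
    then show False by (simp add: d_def)
  qed
  then obtain s where s: "\<And>n. s n \<in> M" "\<And>n. dist x (s n) < d + 1 / real (Suc n)"
    by metis
  have par: "(norm (u - v))\<^sup>2 + 4 * d\<^sup>2 \<le> 2 * (norm (x - u))\<^sup>2 + 2 * (norm (x - v))\<^sup>2"
    if "u \<in> M" "v \<in> M" for u v
  proof -
    have "d \<le> norm (x - (1/2) *\<^sub>R (u + v))"
      using d_le[OF MscaleR[OF Madd[OF that]], of "1/2"] by (simp add: dist_norm)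
    then have "4 * d\<^sup>2 \<le> 4 * (norm (x - (1/2) *\<^sub>R (u + v)))\<^sup>2"
      using d0 by (simp add: power_mono)
    also have "(norm (u - v))\<^sup>2 + 4 * (norm (x - (1/2) *\<^sub>R (u + v)))\<^sup>2
        = 2 * (norm (x - u))\<^sup>2 + 2 * (norm (x - v))\<^sup>2"
      by (simp add: power2_norm_eq_inner inner_diff_left inner_diff_right inner_add_left
          inner_add_right inner_commute algebra_simps)
    finally show ?thesis by simp
  qed
  have lim: "(\<lambda>n. dist x (s n)) \<longlonglongrightarrow> d"
  proof (rule real_tendsto_sandwich[of "\<lambda>_. d" _ _ "\<lambda>n. d + 1 / real (Suc n)"])
    show "(\<lambda>n. d + 1 / real (Suc n)) \<longlonglongrightarrow> d"
      using tendsto_add[OF tendsto_const[of d] LIMSEQ_inverse_real_of_nat]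
      by (simp add: inverse_eq_divide)
    show "\<forall>\<^sub>F n in sequentially. dist x (s n) \<le> d + 1 / real (Suc n)"
      by (intro always_eventually allI less_imp_le s)
  qed (auto simp: d_le s)
  have "Cauchy s"
  proof (rule metric_CauchyI)
    fix e :: real assume e: "e > 0"
    have "(\<lambda>n. (dist x (s n))\<^sup>2) \<longlonglongrightarrow> d\<^sup>2"
      using lim by (intro tendsto_intros)
    moreover have "d\<^sup>2 < d\<^sup>2 + e\<^sup>2 / 4" using e by simp
    ultimately have "eventually (\<lambda>n. (dist x (s n))\<^sup>2 < d\<^sup>2 + e\<^sup>2 / 4) sequentially"
      by (rule order_tendstoD(2))
    then obtain N where N: "\<And>n. n \<ge> N \<Longrightarrow> (dist x (s n))\<^sup>2 < d\<^sup>2 + e\<^sup>2 / 4"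
      by (auto simp: eventually_sequentially)
    show "\<exists>N. \<forall>m\<ge>N. \<forall>n\<ge>N. dist (s m) (s n) < e"
    proof (intro exI allI impI)
      fix m n assume "m \<ge> N" "n \<ge> N"
      then have "(dist (s m) (s n))\<^sup>2 < e\<^sup>2"
        using par[OF s(1)[of m] s(1)[of n]] N[of m] N[of n] unfolding dist_norm by linarith
      then show "dist (s m) (s n) < e"
        using e by (meson less_imp_le power_less_imp_less_base)
    qed
  qed
  then obtain p where p: "s \<longlonglongrightarrow> p"
    by (meson Cauchy_convergent_iff convergent_def)
  have pM: "p \<in> M"
    using closed_sequentially[OF M(2) _ p] s(1) by blast
  have "(\<lambda>n. dist x (s n)) \<longlonglongrightarrow> dist x p"
    by (intro tendsto_intros p)
  then have pd: "dist x p = d" using lim LIMSEQ_unique by blast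
  have re0: "inner (x - p) m = 0" if m: "m \<in> M" for m
  proof (cases "m = 0")
    case False
    define t where "t = inner (x - p) m / inner m m"
    have "(norm (x - p))\<^sup>2 \<le> (norm (x - (p + t *\<^sub>R m)))\<^sup>2"
      using d_le[OF Madd[OF pM MscaleR[OF m, of t]]] pd
      by (intro power_mono) (simp_all add: dist_norm d0)
    also have "\<dots> = (norm (x - p))\<^sup>2 - 2 * t * inner (x - p) m + t * (t * inner m m)"
      unfolding diff_diff_add[symmetric] power2_norm_eq_inner
      by (simp add: inner_diff_left[of "x - p"] inner_diff_right[of _ "x - p"] inner_commute
          right_diff_distrib)
    also have "t * inner m m = inner (x - p) m"
      using False by (simp add: t_def)
    finally have "t * inner (x - p) m \<le> 0" by simp
    then have "(inner (x - p) m)\<^sup>2 / inner m m \<le> 0"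
      by (simp add: t_def power2_eq_square)
    moreover have "inner m m > 0" using False by simp
    ultimately show ?thesis
      by (simp add: divide_le_0_iff)
  qed simp
  have "cinner (x - p) m = 0" if m: "m \<in> M" for m
  proof (rule complex_eqI)
    have "Re (cinner (x - p) (\<i> *\<^sub>C m)) = 0"
      using re0[OF Mscale[OF m]] by (simp add: Re_cinner)
    then show "Im (cinner (x - p) m) = Im 0"
      by (simp add: cinner_scaleC_right)
  qed (simp add: Re_cinner re0 m)
  then have P: "p \<in> M \<and> (\<forall>m\<in>M. cinner (x - p) m = 0)" using pM by blast
  show ?thesis
  proof (rule ex1I[of _ p])
    show "p \<in> M \<and> (\<forall>m\<in>M. cinner (x - p) m = 0)" by (rule P)
  next
    fix q assume q: "q \<in> M \<and> (\<forall>m\<in>M. cinner (x - q) m = 0)"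
    have "p - q \<in> M" using q pM Mdiff by blast
    then have "cinner (x - q) (p - q) - cinner (x - p) (p - q) = 0" using P q by simp
    then have "cinner (p - q) (p - q) = 0" by (simp flip: cinner_diff_left)
    then show "q = p" by (simp add: cinner_self)
  qed
qed

lemma orth_proj:
  fixes M :: "'a::chilbert_space set"
  assumes "complex_vector.subspace M" "closed M"
  shows orth_proj_in: "orth_proj M x \<in> M"
    and orth_proj_orthogonal: "m \<in> M \<Longrightarrow> cinner (x - orth_proj M x) m = 0"
  using theI'[OF orth_proj_ex[OF assms, of x]] unfolding orth_proj_def by blast+

lemma cadjoint:
  fixes A :: "'a::chilbert_space \<Rightarrow> 'a"
  assumes A: "bounded_clinear A"
  shows "cinner (A x) y = cinner x (cadjoint A y)"
proof -
  interpret bounded_linear A using A by (simp add: bounded_clinear_def)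
  have Asc: "A (c *\<^sub>C x) = c *\<^sub>C A x" for c x using A by (simp add: bounded_clinear_def)
  have "\<exists>w. \<forall>x. cinner (A x) y = cinner x w" for y
  proof (cases "\<forall>x. cinner (A x) y = 0")
    case True
    then show ?thesis by (intro exI[of _ 0]) simp
  next
    case False
    define f where "f = (\<lambda>x. cinner (A x) y)"
    define M where "M = {x. f x = 0}"
    have f_add: "f (u + v) = f u + f v" and f_diff: "f (u - v) = f u - f v"
      and f_sc: "f (c *\<^sub>C u) = c * f u" for u v c
      by (simp_all add: f_def add diff Asc cinner_add_left cinner_diff_left cinner_scaleC_left)
    have sub: "complex_vector.subspace M"
      by (auto simp: complex_vector.subspace_def M_def f_add f_sc) (simp add: f_def zero)
    have M_eq: "M = {x. inner (A x) y = 0} \<inter> {x. inner (A x) (\<i> *\<^sub>C y) = 0}"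
      by (auto simp: M_def f_def complex_eq_iff cinner_scaleC_right simp flip: Re_cinner)
    have clo: "closed M"
      unfolding M_eq by (intro closed_Int closed_Collect_eq continuous_intros
          linear_continuous_on bounded_linear_axioms)
    obtain x0 where x0: "f x0 \<noteq> 0" using False by (auto simp: f_def)
    define u where "u = x0 - orth_proj M x0"
    have fu: "f u \<noteq> 0"
      using x0 orth_proj_in[OF sub clo, of x0] by (simp add: u_def f_diff M_def)
    then have u0: "u \<noteq> 0" by (auto simp: f_def zero)
    define w where "w = cnj (f u / (norm u)\<^sup>2) *\<^sub>C u"
    have "f x = cinner x w" for x
    proof -
      have "f (x - (f x / f u) *\<^sub>C u) = 0" using fu by (simp add: f_diff f_sc)
      then have "cinner u (x - (f x / f u) *\<^sub>C u) = 0"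
        unfolding u_def by (intro orth_proj_orthogonal[OF sub clo]) (simp add: M_def)
      then have "cinner (x - (f x / f u) *\<^sub>C u) u = 0"
        by (metis cinner_commute complex_cnj_zero)
      then have "cinner x u = f x / f u * (norm u)\<^sup>2"
        by (simp add: cinner_diff_left cinner_scaleC_left cinner_self)
      then show ?thesis using fu u0 by (simp add: w_def cinner_scaleC_right)
    qed
    then show ?thesis by (auto simp: f_def)
  qed
  then obtain B where B: "\<And>x y. cinner (A x) y = cinner x (B y)" by metis
  have "\<exists>!B. \<forall>x y. cinner (A x) y = cinner x (B y)"
  proof (rule ex1I[of _ B])
    show "\<forall>x y. cinner (A x) y = cinner x (B y)" using B by blast
  next
    fix B' assume B': "\<forall>x y. cinner (A x) y = cinner x (B' y)"
    show "B' = B"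
    proof
      show "B' y = B y" for y
        by (rule cinner_ext) (metis B B')
    qed
  qed
  from theI'[OF this] show ?thesis unfolding cadjoint_def by blast
qed


section \<open>Frames\<close>

text \<open>
  The sums are taken in \<^typ>\<open>ennreal\<close>, so that a divergent sum is \<open>\<infinity>\<close>: it satisfies every lower
  bound and no upper bound.
\<close>

definition frame_sum :: "'i set \<Rightarrow> ('i \<Rightarrow> 'a::complex_inner) \<Rightarrow> 'a \<Rightarrow> ennreal" where
  "frame_sum I z y = (\<Sum>\<^sub>\<infinity>j\<in>I. ennreal ((cmod (cinner y (z j)))\<^sup>2))"

definition lower_frame_condition :: "'a::complex_inner set \<Rightarrow> 'i set \<Rightarrow> ('i \<Rightarrow> 'a) \<Rightarrow> bool" where
  "lower_frame_condition K I z \<longleftrightarrow> countable I \<and> z ` I \<subseteq> K \<and>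
     (\<exists>L>0. \<forall>y\<in>K. ennreal (L * (norm y)\<^sup>2) \<le> frame_sum I z y)"

definition is_frame :: "'a::complex_inner set \<Rightarrow> 'i set \<Rightarrow> ('i \<Rightarrow> 'a) \<Rightarrow> bool" where
  "is_frame K I z \<longleftrightarrow> countable I \<and> z ` I \<subseteq> K \<and>
     (\<exists>L L'. 0 < L \<and> L \<le> L' \<and>
       (\<forall>y\<in>K. ennreal (L * (norm y)\<^sup>2) \<le> frame_sum I z y \<and>
              frame_sum I z y \<le> ennreal (L' * (norm y)\<^sup>2)))"

definition frame_normalizable :: "'a::complex_inner set \<Rightarrow> 'i set \<Rightarrow> ('i \<Rightarrow> 'a) \<Rightarrow> bool" where
  "frame_normalizable K I z \<longleftrightarrow>
     (\<forall>j\<in>I. z j \<noteq> 0) \<and> is_frame K I (\<lambda>j. z j /\<^sub>R norm (z j))"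

definition orbit :: "('a \<Rightarrow> 'a) \<Rightarrow> 'a \<times> nat \<Rightarrow> 'a" where
  "orbit A = (\<lambda>(x, n). (A ^^ n) x)"

definition infinite_dimensional :: "'a::complex_inner set \<Rightarrow> bool" where
  "infinite_dimensional M \<longleftrightarrow> \<not> (\<exists>B. finite B \<and> M \<subseteq> complex_vector.span B)"

end

theory Submission
  imports Defs
begin

text \<open>
  For normal \<open>A\<close> a frame of orbits satisfies \<open>A\<^sup>n \<rightarrow> 0\<close> strongly.  If the normalized family is a frame
  as well, comparing the two frame sums over tails of the orbits makes a power of \<open>A\<close> a strict
  contraction, so the orbits are square summable in norm.  But square summable vectors satisfy a lower
  frame condition only in finite dimension, where infinitely many unit vectors violate every upper
  bound.  This settles (a), to which (b) reduces.  In (d) the vectors \<open>P\<^sub>M A\<^sup>n x\<close> are square summable, so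
  the condition cannot hold at all.  In (c) the adjoint also fixes \<open>w\<^sub>0\<close>, so the terms of the normalized
  frame sum at \<open>w\<^sub>0\<close> stay away from zero.
\<close>

section \<open>Complex inner products\<close>

lemma cinner_sum_left: "cinner (\<Sum>i\<in>I. f i) y = (\<Sum>i\<in>I. cinner (f i) (y :: 'a::complex_inner))"
  by (induction I rule: infinite_finite_induct) (auto simp: cinner_add_left)

lemma cinner_sum_right: "cinner y (\<Sum>i\<in>I. f i) = (\<Sum>i\<in>I. cinner (y :: 'a::complex_inner) (f i))"
  by (induction I rule: infinite_finite_induct) (auto simp: cinner_add_right)

lemma norm_scaleC: "norm (c *\<^sub>C x) = cmod c * norm (x :: 'a::complex_inner)"
proof -
  have "cinner (c *\<^sub>C x) (c *\<^sub>C x) = (c * cnj c) * cinner x x"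
    by (simp only: cinner_scaleC_left cinner_scaleC_right mult_ac)
  then have "complex_of_real ((norm (c *\<^sub>C x))\<^sup>2) = of_real ((cmod c * norm x)\<^sup>2)"
    by (simp only: cinner_self complex_norm_square[symmetric] power_mult_distrib of_real_mult)
  then have "(norm (c *\<^sub>C x))\<^sup>2 = (cmod c * norm x)\<^sup>2"
    by (simp only: of_real_eq_iff)
  then show ?thesis by (simp add: power2_eq_iff_nonneg)
qed

text \<open>Multiplying \<open>x\<close> by the unimodular scalar \<open>c\<close> rotates the
  complex inner product onto its modulus. It then equals a real inner product, and the real
  Cauchy-Schwarz inequality applies.\<close>

lemma cmod_cinner_le: "cmod (cinner x y) \<le> norm x * norm (y :: 'a::complex_inner)"
proof (cases "cinner x y = 0")
  case False
  let ?z = "cinner x y"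
  define c where "c = cnj ?z / of_real (cmod ?z)"
  have c: "cmod c = 1" using False by (simp add: c_def norm_divide)
  have "c * ?z = (?z * cnj ?z) / of_real (cmod ?z)" by (simp add: c_def mult.commute)
  also have "\<dots> = of_real ((cmod ?z)\<^sup>2) / of_real (cmod ?z)" by (simp only: complex_norm_square)
  also have "\<dots> = of_real (cmod ?z)" using False by (simp add: power2_eq_square)
  finally have "c * ?z = of_real (cmod ?z)" .
  then have "cmod (cinner x y) = (c *\<^sub>C x) \<bullet> y"
    by (simp flip: Re_cinner add: cinner_scaleC_left)
  also have "\<dots> \<le> norm (c *\<^sub>C x) * norm y" by (rule norm_cauchy_schwarz)
  finally show ?thesis by (simp add: norm_scaleC c)
qed simp

lemma cinner_scaleR_right: "cinner x (r *\<^sub>R y) = of_real r * cinner x (y :: 'a::complex_inner)"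
  by (simp flip: scaleC_of_real add: cinner_scaleC_right)

text \<open>The residual is orthogonal to the projection \<open>?p\<close>, so the squared norm of
  \<open>?p\<close> is \<open>cinner x ?p\<close>. Cauchy-Schwarz and cancelling one factor
  \<open>norm ?p\<close> finish the argument.\<close>

lemma norm_orth_proj_le:
  fixes M :: "'a::chilbert_space set"
  assumes M: "complex_vector.subspace M" "closed M"
  shows "norm (orth_proj M x) \<le> norm x"
proof -
  let ?p = "orth_proj M x"
  have "cinner (x - ?p) ?p = 0" by (rule orth_proj_orthogonal[OF M orth_proj_in[OF M]])
  then have "of_real ((norm ?p)\<^sup>2) = cinner x ?p" by (simp add: cinner_diff_left cinner_self)
  then have "norm ?p * norm ?p = cmod (cinner x ?p)"
    by (metis norm_of_real abs_of_nonneg zero_le_power2 power2_eq_square)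
  then have "norm ?p * norm ?p \<le> norm x * norm ?p" using cmod_cinner_le by metis
  then show ?thesis
    using mult_right_le_imp_le[of "norm ?p" "norm ?p" "norm x"]
    by (cases "?p = 0") auto
qed

section \<open>Finite-dimensional subspaces through reproducing systems\<close>

lemma reproducing_residual_orthogonal:
  assumes "(\<Sum>e\<in>E. cinner m e *\<^sub>C e) = (m :: 'a::complex_inner)"
  shows "cinner (x - (\<Sum>e\<in>E. cinner x e *\<^sub>C e)) m = 0"
proof -
  have "cinner (\<Sum>e\<in>E. cinner x e *\<^sub>C e) m = (\<Sum>e\<in>E. cinner x e * cinner e m)"
    by (simp add: cinner_sum_left cinner_scaleC_left)
  \<comment> \<open>The map \<open>x\<close> to the sum of \<open>cinner x e *\<^sub>C e\<close> is
    self-adjoint. Moving it to the other argument brings in the reproduction of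
    \<open>m\<close>.\<close>
  also have "\<dots> = (\<Sum>e\<in>E. cinner x (cinner m e *\<^sub>C e))"
    by (intro sum.cong refl) (simp add: cinner_scaleC_right cinner_commute[symmetric] mult.commute)
  also have "\<dots> = cinner x m"
    using assms by (metis cinner_sum_right)
  finally show ?thesis by (simp add: cinner_diff_left)
qed

text \<open>Gram--Schmidt; the reproducing formula already encodes orthonormality as far as it is needed.\<close>

lemma finite_span_reproducing:
  fixes B :: "'a::complex_inner set"
  assumes "finite B"
  shows "\<exists>E. finite E \<and> E \<subseteq> complex_vector.span B \<and>
    (\<forall>x\<in>complex_vector.span B. x = (\<Sum>e\<in>E. cinner x e *\<^sub>C e))"
  using assms
proof (induction B)
  case empty
  then show ?case by (intro exI[of _ "{}"]) auto
next
  case (insert b B)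
  let ?S = "complex_vector.span B" and ?T = "complex_vector.span (insert b B)"
  obtain E where E: "finite E" "E \<subseteq> ?S"
    and rep: "\<And>x. x \<in> ?S \<Longrightarrow> (\<Sum>e\<in>E. cinner x e *\<^sub>C e) = x"
    using insert.IH by metis
  \<comment> \<open>\<open>q\<close> is the projection of \<open>b\<close> onto the old span, so the
    residual \<open>u\<close> is the new orthogonal direction. If \<open>u\<close> vanishes,
    \<open>b\<close> contributes nothing and \<open>E\<close> is kept.\<close>
  define q where "q = (\<Sum>e\<in>E. cinner b e *\<^sub>C e)"
  define u where "u = b - q"
  have qS: "q \<in> ?S"
    unfolding q_def using E(2)
    by (intro complex_vector.span_sum complex_vector.span_scale) auto
  have ST: "?S \<subseteq> ?T" by (intro complex_vector.span_mono) auto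
  have u_orth: "cinner u m = 0" if "m \<in> ?S" for m
    unfolding u_def q_def by (rule reproducing_residual_orthogonal[OF rep[OF that]])
  have uT: "u \<in> ?T" unfolding u_def
    by (intro complex_vector.span_diff complex_vector.span_base insertI1 subsetD[OF ST qS])
  have split: "\<exists>k. \<exists>v\<in>?S. x = k *\<^sub>C u + v" if "x \<in> ?T" for x
  proof -
    obtain k where k: "x - k *\<^sub>C b \<in> ?S"
      using \<open>x \<in> ?T\<close> by (auto simp: complex_vector.span_breakdown_eq)
    have "x = k *\<^sub>C u + (k *\<^sub>C q + (x - k *\<^sub>C b))"
      by (simp add: u_def complex_vector.scale_right_diff_distrib)
    moreover have "k *\<^sub>C q + (x - k *\<^sub>C b) \<in> ?S"
      by (intro complex_vector.span_add complex_vector.span_scale qS k)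
    ultimately show ?thesis by blast
  qed
  show ?case
  proof (cases "u = 0")
    case True
    have "?T \<subseteq> ?S" using split True by (auto simp: complex_vector.scale_zero_right)
    then show ?thesis using E rep ST by (intro exI[of _ E]) auto
  next
    case False
    define w where "w = (1 / complex_of_real (norm u)) *\<^sub>C u"
    \<comment> \<open>Without this the sum over \<open>insert w E\<close> would not split off a
      separate term for \<open>w\<close>.\<close>
    have wE: "w \<notin> E"
    proof
      assume "w \<in> E"
      then have "cinner u w = 0" using E(2) u_orth by blast
      then show False using False by (simp add: w_def cinner_scaleC_right cinner_self)
    qed
    have "x = (\<Sum>e\<in>insert w E. cinner x e *\<^sub>C e)" if "x \<in> ?T" for x
    proof -
      obtain k v where v: "v \<in> ?S" "x = k *\<^sub>C u + v" using split[OF \<open>x \<in> ?T\<close>] by blast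
      have "cinner v u = 0" using u_orth[OF v(1)] cinner_commute[of v u] by simp
      then have "cinner x w *\<^sub>C w = k *\<^sub>C u"
        using False by (simp add: v(2) w_def cinner_add_left cinner_scaleC_left cinner_scaleC_right
            cinner_self scaleC_scaleC power2_eq_square)
      moreover have "(\<Sum>e\<in>E. cinner x e *\<^sub>C e) = (\<Sum>e\<in>E. cinner v e *\<^sub>C e)"
        using E(2) u_orth by (intro sum.cong) (auto simp: v(2) cinner_add_left cinner_scaleC_left)
      ultimately show ?thesis using E(1) wE rep[OF v(1)] by (simp add: v(2))
    qed
    moreover have "w \<in> ?T" unfolding w_def by (intro complex_vector.span_scale uT)
    ultimately show ?thesis using E ST by (intro exI[of _ "insert w E"]) auto
  qed
qed

text \<open>Subtracting from \<open>y\<close> its projection onto the span of \<open>F\<close>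
  leaves a vector of \<open>M\<close> orthogonal to \<open>F\<close>. By \<open>orth\<close> it is
  zero, so \<open>F\<close> spans \<open>M\<close>.\<close>

lemma not_infinite_dimensionalI:
  fixes M :: "'a::complex_inner set"
  assumes M: "complex_vector.subspace M" and F: "finite F" "F \<subseteq> M"
    and orth: "\<And>y. y \<in> M \<Longrightarrow> \<forall>f\<in>F. cinner y f = 0 \<Longrightarrow> y = 0"
  shows "\<not> infinite_dimensional M"
proof -
  let ?S = "complex_vector.span F"
  obtain E where E: "finite E" "E \<subseteq> ?S"
    and rep: "\<And>x. x \<in> ?S \<Longrightarrow> (\<Sum>e\<in>E. cinner x e *\<^sub>C e) = x"
    using finite_span_reproducing[OF F(1)] by metis
  have SM: "?S \<subseteq> M" using F(2) M by (rule complex_vector.span_minimal)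
  have "y \<in> ?S" if y: "y \<in> M" for y
  proof -
    define q where "q = (\<Sum>e\<in>E. cinner y e *\<^sub>C e)"
    have qS: "q \<in> ?S"
      unfolding q_def using E(2)
      by (intro complex_vector.span_sum complex_vector.span_scale) auto
    have "cinner (y - q) m = 0" if "m \<in> F" for m
      unfolding q_def
      by (rule reproducing_residual_orthogonal[OF rep[OF complex_vector.span_base[OF that]]])
    moreover have "y - q \<in> M" using M y qS SM by (blast intro: complex_vector.subspace_diff)
    ultimately have "y - q = 0" by (intro orth) auto
    then show ?thesis using qS by simp
  qed
  then show ?thesis unfolding infinite_dimensional_def using F(1) by blast
qed

text \<open>In finite dimension a finite reproducing system writes the squared norm of
  \<open>u n\<close> as a finite sum of products of coefficients. Weak nullity sends this sum to 0,
  although it is constantly 1.\<close>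

lemma weakly_null_unit_infinite_dimensional:
  fixes u :: "nat \<Rightarrow> 'a::complex_inner"
  assumes unit: "\<And>n. norm (u n) = 1" and weak: "\<And>y. (\<lambda>n. cinner y (u n)) \<longlonglongrightarrow> 0"
  shows "infinite_dimensional (UNIV :: 'a set)"
proof (rule ccontr)
  assume "\<not> ?thesis"
  then obtain B :: "'a set" where B: "finite B" "complex_vector.span B = UNIV"
    unfolding infinite_dimensional_def by blast
  obtain E where E: "finite E" and rep: "\<And>x :: 'a. (\<Sum>e\<in>E. cinner x e *\<^sub>C e) = x"
    using finite_span_reproducing[OF B(1)] B(2) by (metis UNIV_I)
  have "1 = (\<Sum>e\<in>E. cinner (u n) e * cinner e (u n))" for n
    using arg_cong[OF rep[of "u n"], of "\<lambda>x. cinner x (u n)"]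
    by (simp add: cinner_sum_left cinner_scaleC_left cinner_self unit)
  moreover have "(\<lambda>n. \<Sum>e\<in>E. cinner (u n) e * cinner e (u n)) \<longlonglongrightarrow> (\<Sum>e\<in>E. cnj 0 * 0)"
    unfolding cinner_commute[of "u _"] by (intro tendsto_intros weak)
  ultimately have "(\<lambda>n::nat. 1::complex) \<longlonglongrightarrow> 0" by simp
  then show False using LIMSEQ_unique tendsto_const by fastforce
qed

section \<open>Frame sums over finitely many sequences\<close>

lemma infsum_ennreal_suminf: "(\<Sum>\<^sub>\<infinity>n. f n) = (\<Sum>n. f n)" for f :: "nat \<Rightarrow> ennreal"
proof -
  have "(f has_sum infsum f UNIV) UNIV"
    by (intro has_sum_infsum nonneg_summable_on_complete) simp
  then have "f sums infsum f UNIV" by (rule has_sum_imp_sums)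
  then show ?thesis by (simp add: sums_iff)
qed

text \<open>Splitting the unordered sum into one series per element of \<open>S\<close> makes the
  theory of series over the naturals available; the induction peels off one fibre at a time.\<close>

lemma frame_sum_Times:
  assumes "finite S"
  shows "frame_sum (S \<times> UNIV) z y = (\<Sum>x\<in>S. \<Sum>n. ennreal ((cmod (cinner y (z (x, n :: nat))))\<^sup>2))"
  unfolding frame_sum_def using assms
proof (induction S)
  case (insert x S)
  let ?g = "\<lambda>j. ennreal ((cmod (cinner y (z j)))\<^sup>2)"
  have un: "insert x S \<times> UNIV = Pair x ` (UNIV :: nat set) \<union> S \<times> UNIV" by auto
  have disj: "Pair x ` (UNIV :: nat set) \<inter> S \<times> UNIV = {}" using insert.hyps(2) by auto
  have "infsum ?g (insert x S \<times> UNIV)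
      = infsum ?g (Pair x ` (UNIV :: nat set)) + infsum ?g (S \<times> UNIV)"
    unfolding un
    by (intro infsum_Un_disjoint[OF _ _ disj] nonneg_summable_on_complete zero_le)
  also have "infsum ?g (Pair x ` (UNIV :: nat set)) = (\<Sum>n. ?g (x, n))"
    by (subst infsum_reindex) (auto simp only: inj_on_def o_def infsum_ennreal_suminf prod.inject)
  finally show ?case by (simp only: insert.IH sum.insert[OF insert.hyps(1,2)])
qed (simp only: Sigma_empty1 infsum_empty sum.empty)

text \<open>Each single series is dominated by the whole frame sum. Being finite in
  \<open>ennreal\<close>, it converges as a real series.\<close>

lemma frame_sum_summable:
  assumes S: "finite S" and le: "frame_sum (S \<times> UNIV) z y \<le> ennreal c" and x: "x \<in> S"
  shows "summable (\<lambda>n. (cmod (cinner y (z (x, n :: nat))))\<^sup>2)"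
proof (rule summable_suminf_not_top)
  have "(\<Sum>n. ennreal ((cmod (cinner y (z (x, n))))\<^sup>2)) \<le> frame_sum (S \<times> UNIV) z y"
    unfolding frame_sum_Times[OF S] using S x
    by (intro member_le_sum[of x S "\<lambda>x. \<Sum>n. ennreal ((cmod (cinner y (z (x, n))))\<^sup>2)"]) auto
  also have "\<dots> < top" using le ennreal_less_top le_less_trans by blast
  finally show "(\<Sum>n. ennreal ((cmod (cinner y (z (x, n))))\<^sup>2)) \<noteq> top" by simp
qed simp

lemma frame_sum_suminf:
  assumes "finite S" and "\<And>x. x \<in> S \<Longrightarrow> summable (\<lambda>n. (cmod (cinner y (z (x, n :: nat))))\<^sup>2)"
  shows "frame_sum (S \<times> UNIV) z y = ennreal (\<Sum>x\<in>S. \<Sum>n. (cmod (cinner y (z (x, n))))\<^sup>2)"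
  using assms by (simp add: frame_sum_Times suminf_ennreal2 sum_ennreal suminf_nonneg)

text \<open>Beyond some \<open>N\<close> the squared norms add up to less than \<open>L\<close>. If
  \<open>y\<close> in \<open>M\<close> is orthogonal to the finitely many earlier vectors,
  Cauchy-Schwarz bounds its frame sum by that tail times its squared norm. The lower bound
  \<open>L\<close> then forces \<open>y = 0\<close>, so the earlier vectors span
  \<open>M\<close>.\<close>

lemma lower_frame_square_summable_finite_dimensional:
  fixes M :: "'a::complex_inner set" and z :: "'i \<times> nat \<Rightarrow> 'a"
  assumes M: "complex_vector.subspace M" and S: "finite S"
    and lower: "lower_frame_condition M (S \<times> UNIV) z"
    and sq: "\<And>x. x \<in> S \<Longrightarrow> summable (\<lambda>n. (norm (z (x, n)))\<^sup>2)"
  shows "\<not> infinite_dimensional M"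
proof -
  obtain L where L: "L > 0" "\<And>y. y \<in> M \<Longrightarrow> ennreal (L * (norm y)\<^sup>2) \<le> frame_sum (S \<times> UNIV) z y"
    and zM: "z ` (S \<times> UNIV) \<subseteq> M"
    using lower unfolding lower_frame_condition_def by blast
  have "(\<lambda>N. \<Sum>x\<in>S. \<Sum>n. (norm (z (x, n + N)))\<^sup>2) \<longlonglongrightarrow> (\<Sum>x\<in>S. 0)"
    by (intro tendsto_sum suminf_exist_split2 sq)
  then have "(\<lambda>N. \<Sum>x\<in>S. \<Sum>n. (norm (z (x, n + N)))\<^sup>2) \<longlonglongrightarrow> 0" by simp
  then have "eventually (\<lambda>N. (\<Sum>x\<in>S. \<Sum>n. (norm (z (x, n + N)))\<^sup>2) < L) sequentially"
    using L(1) by (rule order_tendstoD(2))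
  then obtain N where N: "(\<Sum>x\<in>S. \<Sum>n. (norm (z (x, n + N)))\<^sup>2) < L"
    by (auto simp: eventually_sequentially)
  let ?F = "z ` (S \<times> {..<N})"
  show ?thesis
  proof (rule not_infinite_dimensionalI[OF M])
    show "finite ?F" using S by simp
    show "?F \<subseteq> M" using zM by auto
    fix y assume y: "y \<in> M" and orth: "\<forall>f\<in>?F. cinner y f = 0"
    have le: "(cmod (cinner y (z j)))\<^sup>2 \<le> (norm y)\<^sup>2 * (norm (z j))\<^sup>2" for j
      using power_mono[OF cmod_cinner_le[of y "z j"], of 2] by (simp add: power_mult_distrib)
    have summ: "summable (\<lambda>n. (cmod (cinner y (z (x, n))))\<^sup>2)" if "x \<in> S" for x
      by (rule summable_comparison_test_ev[OF _ summable_mult[OF sq[OF that]]])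
        (auto intro!: always_eventually le)
    have "(\<Sum>n. (cmod (cinner y (z (x, n))))\<^sup>2) \<le> (norm y)\<^sup>2 * (\<Sum>n. (norm (z (x, n + N)))\<^sup>2)"
      if "x \<in> S" for x
    proof -
      have "(\<Sum>n. (cmod (cinner y (z (x, n))))\<^sup>2)
          = (\<Sum>n. (cmod (cinner y (z (x, n + N))))\<^sup>2) + (\<Sum>n<N. (cmod (cinner y (z (x, n))))\<^sup>2)"
        by (rule suminf_split_initial_segment[OF summ[OF that]])
      also have "(\<Sum>n<N. (cmod (cinner y (z (x, n))))\<^sup>2) = 0"
        using orth that by (intro sum.neutral) auto
      also have "(\<Sum>n. (cmod (cinner y (z (x, n + N))))\<^sup>2)
          \<le> (\<Sum>n. (norm y)\<^sup>2 * (norm (z (x, n + N)))\<^sup>2)"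
        using summ[OF that] sq[OF that]
        by (intro suminf_le le summable_mult summable_ignore_initial_segment)
      also have "\<dots> = (norm y)\<^sup>2 * (\<Sum>n. (norm (z (x, n + N)))\<^sup>2)"
        using sq[OF that] by (intro suminf_mult summable_ignore_initial_segment)
      finally show ?thesis by simp
    qed
    then have up: "(\<Sum>x\<in>S. \<Sum>n. (cmod (cinner y (z (x, n))))\<^sup>2)
        \<le> (norm y)\<^sup>2 * (\<Sum>x\<in>S. \<Sum>n. (norm (z (x, n + N)))\<^sup>2)"
      unfolding sum_distrib_left by (rule sum_mono)
    have "L * (norm y)\<^sup>2 \<le> (\<Sum>x\<in>S. \<Sum>n. (cmod (cinner y (z (x, n))))\<^sup>2)"
    proof -
      \<comment> \<open>\<open>ennreal\<close> truncates negative reals, so the inequality can be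
        pulled back to the reals once its right-hand side is known to be nonnegative.\<close>
      have "0 \<le> (\<Sum>x\<in>S. \<Sum>n. (cmod (cinner y (z (x, n))))\<^sup>2)"
        by (intro sum_nonneg suminf_nonneg summ) auto
      moreover have "ennreal (L * (norm y)\<^sup>2)
          \<le> ennreal (\<Sum>x\<in>S. \<Sum>n. (cmod (cinner y (z (x, n))))\<^sup>2)"
        using L(2)[OF y] by (simp only: frame_sum_suminf[OF S summ])
      ultimately show ?thesis by (simp only: ennreal_le_iff)
    qed
    with up have "(norm y)\<^sup>2 * L \<le> (norm y)\<^sup>2 * (\<Sum>x\<in>S. \<Sum>n. (norm (z (x, n + N)))\<^sup>2)"
      by (simp add: mult.commute)
    moreover have "(norm y)\<^sup>2 * (\<Sum>x\<in>S. \<Sum>n. (norm (z (x, n + N)))\<^sup>2) < (norm y)\<^sup>2 * L"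
      if "y \<noteq> 0"
      using that by (intro mult_strict_left_mono N) simp
    ultimately show "y = 0" by (meson not_le)
  qed
qed

section \<open>Orbits of normal operators\<close>

text \<open>If \<open>P N\<close> is the sum of the first \<open>N\<close> terms, then
  \<open>P N\<close> is at most \<open>P m + c * P N\<close>. Solving for \<open>P N\<close> bounds
  all partial sums by \<open>P m / (1 - c)\<close>.\<close>

lemma summable_if_contracting:
  fixes f :: "nat \<Rightarrow> real"
  assumes f0: "\<And>n. f n \<ge> 0" and c: "c < 1" and contr: "\<And>n. f (n + m) \<le> c * f n"
  shows "summable f"
proof (rule summableI_nonneg_bounded)
  fix N
  have "(\<Sum>n<N. f n) \<le> (\<Sum>n<m + N. f n)"
    by (intro sum_mono2 f0) auto
  also have "\<dots> = (\<Sum>n<m. f n) + (\<Sum>n<N. f (n + m))"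
    by (induction N) (simp_all add: add.commute)
  also have "(\<Sum>n<N. f (n + m)) \<le> c * (\<Sum>n<N. f n)"
    unfolding sum_distrib_left by (intro sum_mono contr)
  finally show "(\<Sum>n<N. f n) \<le> (\<Sum>n<m. f n) / (1 - c)"
    using c by (simp add: field_simps)
qed (rule f0)

section \<open>Adjoint pairs and normality\<close>

lemma cinner_funpow_adjoint:
  fixes A B :: "'a::complex_inner \<Rightarrow> 'a"
  assumes "\<And>x y. cinner (A x) y = cinner x (B y)"
  shows "cinner ((A ^^ n) x) y = cinner x ((B ^^ n) y)"
proof (induction n arbitrary: x y)
  case (Suc n)
  have "cinner ((A ^^ Suc n) x) y = cinner x ((B ^^ n) (B y))" by (simp add: assms Suc)
  then show ?case by (simp only: funpow_Suc_right o_apply)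
qed simp

lemma cinner_adjoint_left:
  assumes "\<And>x y. cinner (A x) y = cinner x (B y)"
  shows "cinner (B x) y = cinner x (A y)"
  by (metis assms cinner_commute)

text \<open>Both squared norms equal the inner product of \<open>x\<close> with
  \<open>A (B x) = B (A x)\<close>. The form with an arbitrary adjoint pair serves powers of a
  normal operator as well as its shift by the identity.\<close>

lemma norm_normal_adjoint:
  assumes adj: "\<And>x y. cinner (A x) y = cinner x (B y)" and comm: "\<And>x. A (B x) = B (A x)"
  shows "norm (A x) = norm (B x)"
proof -
  have "complex_of_real ((norm (A x))\<^sup>2) = of_real ((norm (B x))\<^sup>2)"
    unfolding cinner_self[symmetric]
    by (simp add: adj comm[symmetric] cinner_adjoint_left[OF adj])
  then have "(norm (A x))\<^sup>2 = (norm (B x))\<^sup>2" by (simp only: of_real_eq_iff)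
  then show ?thesis by (simp add: power2_eq_iff_nonneg)
qed

lemma norm_funpow_cadjoint:
  fixes A :: "'a::chilbert_space \<Rightarrow> 'a"
  assumes "normal_operator A"
  shows "norm ((A ^^ n) x) = norm ((cadjoint A ^^ n) x)"
proof -
  have b: "bounded_clinear A" and c: "A \<circ> cadjoint A = cadjoint A \<circ> A"
    using assms by (auto simp: normal_operator_def)
  have adj: "cinner ((A ^^ n) x) y = cinner x ((cadjoint A ^^ n) y)" for x y
    by (rule cinner_funpow_adjoint) (rule cadjoint[OF b])
  \<comment> \<open>Commutation passes to powers in two inductions: first powers of \<open>A\<close>
    against one adjoint, then against powers of the adjoint.\<close>
  have 1: "(A ^^ n) (cadjoint A x) = cadjoint A ((A ^^ n) x)" for n x
    by (induction n) (use c in \<open>simp_all add: fun_eq_iff\<close>)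
  have "(A ^^ n) ((cadjoint A ^^ k) x) = (cadjoint A ^^ k) ((A ^^ n) x)" for k x
    by (induction k) (simp_all add: 1)
  then show ?thesis
    using norm_normal_adjoint[of "A ^^ n" "cadjoint A ^^ n"] adj by blast
qed

text \<open>\<open>A\<close> minus the identity, here \<open>T\<close>, commutes with its adjoint
  \<open>U\<close>. So \<open>T\<close> and \<open>U\<close> have equal norms at \<open>w\<close>,
  and \<open>T w = 0\<close>.\<close>

lemma cadjoint_fixed_point:
  fixes A :: "'a::chilbert_space \<Rightarrow> 'a"
  assumes A: "normal_operator A" and w: "A w = w"
  shows "cadjoint A w = w"
proof -
  define T where "T x = A x - x" for x
  define U where "U x = cadjoint A x - x" for x
  have b: "bounded_clinear A" and c: "A (cadjoint A x) = cadjoint A (A x)" for x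
    using A by (auto simp: normal_operator_def fun_eq_iff)
  have adj: "cinner (A x) y = cinner x (cadjoint A y)" for x y by (rule cadjoint[OF b])
  have "linear A" using b by (simp add: bounded_clinear_def bounded_linear.linear)
  have cdiff: "cadjoint A (x - y) = cadjoint A x - cadjoint A y" for x y
    by (rule cinner_ext) (simp add: adj[symmetric] cinner_diff_right)
  have "norm (T w) = norm (U w)"
    by (rule norm_normal_adjoint)
      (auto simp: T_def U_def cinner_diff_left cinner_diff_right adj c cdiff
        linear_diff[OF \<open>linear A\<close>])
  then show ?thesis by (simp add: T_def U_def w)
qed

text \<open>
  Applying the lower bound to powers of the adjoint shifts the frame sum into its tail.  This first
  gives \<open>A\<^sup>n \<rightarrow> 0\<close> strongly; comparing the tail with the normalized family then upgrades this to a
  power of \<open>A\<close> being a strict contraction.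
\<close>

lemma orbit_square_summable:
  fixes A :: "'a::chilbert_space \<Rightarrow> 'a"
  assumes A: "normal_operator A" and S: "finite S"
    and nonzero: "\<And>x n. x \<in> S \<Longrightarrow> (A ^^ n) x \<noteq> 0"
    and L: "L > 0"
    and summ: "\<And>x y. x \<in> S \<Longrightarrow> summable (\<lambda>n. (cmod (cinner y ((A ^^ n) x)))\<^sup>2)"
    and lower: "\<And>y. L * (norm y)\<^sup>2 \<le> (\<Sum>x\<in>S. \<Sum>n. (cmod (cinner y ((A ^^ n) x)))\<^sup>2)"
    and summ': "\<And>x y. x \<in> S \<Longrightarrow>
      summable (\<lambda>n. (cmod (cinner y ((A ^^ n) x)))\<^sup>2 / (norm ((A ^^ n) x))\<^sup>2)"
    and upper: "\<And>y. (\<Sum>x\<in>S. \<Sum>n. (cmod (cinner y ((A ^^ n) x)))\<^sup>2 / (norm ((A ^^ n) x))\<^sup>2)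
      \<le> C * (norm y)\<^sup>2"
    and x: "x \<in> S"
  shows "summable (\<lambda>n. (norm ((A ^^ n) x))\<^sup>2)"
proof -
  have b: "bounded_clinear A" using A by (simp add: normal_operator_def)
  let ?g = "\<lambda>y x n. (cmod (cinner y ((A ^^ n) x)))\<^sup>2"
  \<comment> \<open>This is the lower bound at \<open>(cadjoint A ^^ m) y\<close>. Normality
    replaces the norm of that vector by the norm of \<open>(A ^^ m) y\<close>.\<close>
  have tail: "L * (norm ((A ^^ m) y))\<^sup>2 \<le> (\<Sum>x\<in>S. \<Sum>n. ?g y x (n + m))" for m y
  proof -
    have "cinner ((cadjoint A ^^ m) y) ((A ^^ n) x) = cinner y ((A ^^ (n + m)) x)" for n x
    proof -
      have "cinner ((cadjoint A ^^ m) y) v = cinner y ((A ^^ m) v)" for v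
        by (rule cinner_adjoint_left[OF cinner_funpow_adjoint[OF cadjoint[OF b]]])
      then show ?thesis by (simp add: funpow_add add.commute[of n m])
    qed
    then show ?thesis
      using lower[of "(cadjoint A ^^ m) y"] by (simp add: norm_funpow_cadjoint[OF A])
  qed
  have lim: "(\<lambda>m. (norm ((A ^^ m) y))\<^sup>2) \<longlonglongrightarrow> 0" for y
  proof (rule real_tendsto_sandwich[where f = "\<lambda>_. 0"])
    have "(\<lambda>m. (\<Sum>x\<in>S. \<Sum>n. ?g y x (n + m)) / L) \<longlonglongrightarrow> (\<Sum>x\<in>S. 0) / L"
      using L by (intro tendsto_divide tendsto_sum suminf_exist_split2 summ tendsto_const) auto
    then show "(\<lambda>m. (\<Sum>x\<in>S. \<Sum>n. ?g y x (n + m)) / L) \<longlonglongrightarrow> 0" by simp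
    show "\<forall>\<^sub>F m in sequentially. (norm ((A ^^ m) y))\<^sup>2 \<le> (\<Sum>x\<in>S. \<Sum>n. ?g y x (n + m)) / L"
      using tail L by (intro always_eventually) (simp add: field_simps)
  qed (auto intro!: always_eventually)
  have C: "C \<ge> 0"
  proof -
    have "0 \<le> (\<Sum>x'\<in>S. \<Sum>n. ?g x x' n / (norm ((A ^^ n) x'))\<^sup>2)"
      by (intro sum_nonneg suminf_nonneg summ') auto
    then have "0 \<le> C * (norm x)\<^sup>2" using upper[of x] by linarith
    then show ?thesis using nonzero[OF x, of 0] by (simp add: zero_le_mult_iff)
  qed
  \<comment> \<open>Chosen so that \<open>\<epsilon> * C\<close> is at most \<open>L / 2\<close>;
    the summand 1 keeps the denominator positive when \<open>C = 0\<close>.\<close>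
  define \<epsilon> where "\<epsilon> = L / (2 * (C + 1))"
  have \<epsilon>: "\<epsilon> > 0" using L C by (simp add: \<epsilon>_def)
  have "\<forall>x\<in>S. eventually (\<lambda>m. (norm ((A ^^ m) x))\<^sup>2 < \<epsilon>) sequentially"
    by (intro ballI order_tendstoD(2)[OF lim \<epsilon>])
  then have "eventually (\<lambda>m. \<forall>x\<in>S. (norm ((A ^^ m) x))\<^sup>2 < \<epsilon>) sequentially"
    by (simp add: eventually_ball_finite_distrib S)
  then obtain m where m: "\<And>n x. n \<ge> m \<Longrightarrow> x \<in> S \<Longrightarrow> (norm ((A ^^ n) x))\<^sup>2 < \<epsilon>"
    unfolding eventually_sequentially by blast
  \<comment> \<open>From index \<open>m\<close> on, each coefficient is at most
    \<open>\<epsilon>\<close> times the normalized one, so \<open>upper\<close> controls the tail.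
    Since \<open>m\<close> was fixed before \<open>y\<close>, the contraction is uniform.\<close>
  have contr: "(norm ((A ^^ m) y))\<^sup>2 \<le> 1/2 * (norm y)\<^sup>2" for y
  proof -
    let ?h = "\<lambda>x n. ?g y x n / (norm ((A ^^ n) x))\<^sup>2"
    have "(\<Sum>n. ?g y x (n + m)) \<le> \<epsilon> * (\<Sum>n. ?h x n)" if x: "x \<in> S" for x
    proof -
      have "(\<Sum>n. ?g y x (n + m)) \<le> (\<Sum>n. \<epsilon> * ?h x (n + m))"
      proof (intro suminf_le summable_mult summable_ignore_initial_segment[OF summ[OF x]]
          summable_ignore_initial_segment[OF summ'[OF x]])
        fix n
        have "?g y x (n + m) = (norm ((A ^^ (n + m)) x))\<^sup>2 * ?h x (n + m)"
          using nonzero[OF x, of "n + m"] by simp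
        also have "\<dots> \<le> \<epsilon> * ?h x (n + m)"
          using m[OF _ x, of "n + m"] by (intro mult_right_mono) auto
        finally show "?g y x (n + m) \<le> \<epsilon> * ?h x (n + m)" .
      qed
      also have "\<dots> = \<epsilon> * (\<Sum>n. ?h x (n + m))"
        by (intro suminf_mult summable_ignore_initial_segment[OF summ'[OF x]])
      also have "(\<Sum>n. ?h x (n + m)) \<le> (\<Sum>n. ?h x n)"
        by (subst suminf_split_initial_segment[OF summ'[OF x], of _ m])
          (simp add: sum_nonneg)
      finally show ?thesis using \<epsilon> by simp
    qed
    then have "(\<Sum>x\<in>S. \<Sum>n. ?g y x (n + m)) \<le> \<epsilon> * (\<Sum>x\<in>S. \<Sum>n. ?h x n)"
      unfolding sum_distrib_left by (rule sum_mono)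
    also have "\<dots> \<le> \<epsilon> * (C * (norm y)\<^sup>2)"
      using upper[of y] \<epsilon> by (intro mult_left_mono) auto
    finally have "L * (norm ((A ^^ m) y))\<^sup>2 \<le> \<epsilon> * C * (norm y)\<^sup>2"
      using tail[of m y] by simp
    also have "\<dots> \<le> L / 2 * (norm y)\<^sup>2"
      using L C by (intro mult_right_mono) (auto simp: \<epsilon>_def field_simps)
    finally show ?thesis using L by simp
  qed
  show ?thesis
  proof (rule summable_if_contracting)
    show "(norm ((A ^^ (n + m)) x))\<^sup>2 \<le> 1/2 * (norm ((A ^^ n) x))\<^sup>2" for n
      using contr[of "(A ^^ n) x"] by (simp add: funpow_add add.commute[of n m])
  qed auto
qed

section \<open>Frames of orbits and their normalizations\<close>

lemma is_frameE:
  assumes "is_frame UNIV I z"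
  obtains L L' where "0 < L" "L \<le> L'"
    "\<And>y. ennreal (L * (norm y)\<^sup>2) \<le> frame_sum I z y"
    "\<And>y. frame_sum I z y \<le> ennreal (L' * (norm y)\<^sup>2)"
  using assms unfolding is_frame_def by blast

text \<open>This carries the upper frame bound of the normalized family over to real series.
  Nonnegativity of \<open>C\<close> keeps \<open>ennreal\<close> from truncating the bound.\<close>

lemma normalized_orbit_sum:
  fixes A :: "'a::complex_inner \<Rightarrow> 'a"
  assumes S: "finite S"
    and le: "\<And>y. frame_sum (S \<times> UNIV) (\<lambda>j. orbit A j /\<^sub>R norm (orbit A j)) y
      \<le> ennreal (C * (norm y)\<^sup>2)"
    and C: "C \<ge> 0"
  shows "x \<in> S \<Longrightarrow> summable (\<lambda>n. (cmod (cinner y ((A ^^ n) x)))\<^sup>2 / (norm ((A ^^ n) x))\<^sup>2)"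
    and "(\<Sum>x\<in>S. \<Sum>n. (cmod (cinner y ((A ^^ n) x)))\<^sup>2 / (norm ((A ^^ n) x))\<^sup>2) \<le> C * (norm y)\<^sup>2"
    and "frame_sum (S \<times> UNIV) (\<lambda>j. orbit A j /\<^sub>R norm (orbit A j)) y
      = ennreal (\<Sum>x\<in>S. \<Sum>n. (cmod (cinner y ((A ^^ n) x)))\<^sup>2 / (norm ((A ^^ n) x))\<^sup>2)"
proof -
  let ?z = "\<lambda>j. orbit A j /\<^sub>R norm (orbit A j)"
  have eq: "(cmod (cinner y (?z (x, n))))\<^sup>2
      = (cmod (cinner y ((A ^^ n) x)))\<^sup>2 / (norm ((A ^^ n) x))\<^sup>2" for x n
    by (simp add: orbit_def cinner_scaleR_right norm_mult norm_inverse power_mult_distrib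
        power_inverse divide_inverse mult.commute)
  have summ: "summable (\<lambda>n. (cmod (cinner y (?z (x, n))))\<^sup>2)" if "x \<in> S" for x
    by (rule frame_sum_summable[OF S le that])
  then show "summable (\<lambda>n. (cmod (cinner y ((A ^^ n) x)))\<^sup>2 / (norm ((A ^^ n) x))\<^sup>2)"
    if "x \<in> S" using that unfolding eq .
  show sum: "frame_sum (S \<times> UNIV) ?z y
      = ennreal (\<Sum>x\<in>S. \<Sum>n. (cmod (cinner y ((A ^^ n) x)))\<^sup>2 / (norm ((A ^^ n) x))\<^sup>2)"
    using frame_sum_suminf[OF S summ] unfolding eq .
  show "(\<Sum>x\<in>S. \<Sum>n. (cmod (cinner y ((A ^^ n) x)))\<^sup>2 / (norm ((A ^^ n) x))\<^sup>2) \<le> C * (norm y)\<^sup>2"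
    using le[of y] C unfolding sum by (simp add: ennreal_le_iff)
qed

text \<open>Both frames together make the orbits square summable, so the lower bound forces finite
  dimension. The upper bound of the normalized family makes its members along one orbit a weakly
  null sequence of unit vectors, which forces infinite dimension.\<close>

lemma orbit_not_frame_and_normalizable:
  fixes A :: "'a::chilbert_space \<Rightarrow> 'a"
  assumes A: "normal_operator A" and S: "finite S" "S \<noteq> {}"
    and nonzero: "\<forall>x\<in>S. \<forall>n. (A ^^ n) x \<noteq> 0"
    and frame: "is_frame UNIV (S \<times> UNIV) (orbit A)"
  shows "\<not> frame_normalizable UNIV (S \<times> UNIV) (orbit A)"
proof
  assume "frame_normalizable UNIV (S \<times> UNIV) (orbit A)"
  then have "is_frame UNIV (S \<times> UNIV) (\<lambda>j. orbit A j /\<^sub>R norm (orbit A j))"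
    by (simp only: frame_normalizable_def)
  then obtain B C where "0 < B" "B \<le> C"
    and C: "\<And>y. frame_sum (S \<times> UNIV) (\<lambda>j. orbit A j /\<^sub>R norm (orbit A j)) y
      \<le> ennreal (C * (norm y)\<^sup>2)"
    by (rule is_frameE) blast
  then have C0: "C \<ge> 0" by linarith
  obtain L L' where L: "L > 0"
    and lower: "\<And>y. ennreal (L * (norm y)\<^sup>2) \<le> frame_sum (S \<times> UNIV) (orbit A) y"
    and upper: "\<And>y. frame_sum (S \<times> UNIV) (orbit A) y \<le> ennreal (L' * (norm y)\<^sup>2)"
    using frame by (rule is_frameE) blast
  have summ: "summable (\<lambda>n. (cmod (cinner y ((A ^^ n) x)))\<^sup>2)" if "x \<in> S" for x y
    using frame_sum_summable[OF S(1) upper that] by (simp add: orbit_def)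
  note norms = normalized_orbit_sum[OF S(1) C C0]
  have sq: "summable (\<lambda>n. (norm ((A ^^ n) x))\<^sup>2)" if "x \<in> S" for x
  proof (rule orbit_square_summable[OF A S(1) _ L summ _ norms(1,2) that])
    show "L * (norm y)\<^sup>2 \<le> (\<Sum>x\<in>S. \<Sum>n. (cmod (cinner y ((A ^^ n) x)))\<^sup>2)" for y
    proof -
      have "0 \<le> (\<Sum>x\<in>S. \<Sum>n. (cmod (cinner y ((A ^^ n) x)))\<^sup>2)"
        by (intro sum_nonneg suminf_nonneg summ) auto
      moreover have "frame_sum (S \<times> UNIV) (orbit A) y
          = ennreal (\<Sum>x\<in>S. \<Sum>n. (cmod (cinner y ((A ^^ n) x)))\<^sup>2)"
        using frame_sum_suminf[OF S(1), of y "orbit A"] summ by (simp add: orbit_def)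
      ultimately show ?thesis using lower[of y] by (simp only: ennreal_le_iff)
    qed
  qed (use nonzero in auto)
  have "lower_frame_condition UNIV (S \<times> UNIV) (orbit A)"
    using frame unfolding is_frame_def lower_frame_condition_def by blast
  then have "\<not> infinite_dimensional (UNIV :: 'a set)"
    using S(1) sq
    by (intro lower_frame_square_summable_finite_dimensional) (auto simp: orbit_def)
  moreover obtain x where x: "x \<in> S" using S(2) by blast
  define u where "u n = (A ^^ n) x /\<^sub>R norm ((A ^^ n) x)" for n
  have "infinite_dimensional (UNIV :: 'a set)"
  proof (rule weakly_null_unit_infinite_dimensional[of u])
    show "norm (u n) = 1" for n using nonzero x by (simp add: u_def)
    fix y
    have "(\<lambda>n. (cmod (cinner y (u n)))\<^sup>2) \<longlonglongrightarrow> 0"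
      using summable_LIMSEQ_zero[OF frame_sum_summable[OF S(1) C x]]
      by (simp add: orbit_def u_def)
    then have "(\<lambda>n. sqrt ((cmod (cinner y (u n)))\<^sup>2)) \<longlonglongrightarrow> sqrt 0"
      by (rule tendsto_real_sqrt)
    then show "(\<lambda>n. cinner y (u n)) \<longlonglongrightarrow> 0"
      by (simp add: tendsto_norm_zero_iff)
  qed
  ultimately show False by blast
qed

text \<open>Each coefficient of the orbit lies between \<open>B\<^sup>2\<close> and
  \<open>D\<^sup>2\<close> times the normalized one, so the frame bounds carry over up to these
  factors.\<close>

lemma orbit_frame_if_norm_bounded:
  fixes A :: "'a::complex_inner \<Rightarrow> 'a"
  assumes S: "finite S" and nonzero: "\<forall>x\<in>S. \<forall>n. (A ^^ n) x \<noteq> 0"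
    and B0: "0 < B"
    and bd: "\<forall>n. \<forall>x\<in>S. B \<le> norm ((A ^^ n) x) \<and> norm ((A ^^ n) x) \<le> D"
    and nf: "frame_normalizable UNIV (S \<times> UNIV) (orbit A)"
  shows "is_frame UNIV (S \<times> UNIV) (orbit A)"
proof -
  have nf': "is_frame UNIV (S \<times> UNIV) (\<lambda>j. orbit A j /\<^sub>R norm (orbit A j))"
    using nf by (simp only: frame_normalizable_def)
  then obtain L C where L: "0 < L" and LC: "L \<le> C"
    and lower: "\<And>y. ennreal (L * (norm y)\<^sup>2)
      \<le> frame_sum (S \<times> UNIV) (\<lambda>j. orbit A j /\<^sub>R norm (orbit A j)) y"
    and upper: "\<And>y. frame_sum (S \<times> UNIV) (\<lambda>j. orbit A j /\<^sub>R norm (orbit A j)) y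
      \<le> ennreal (C * (norm y)\<^sup>2)"
    by (rule is_frameE) blast
  have countable: "countable (S \<times> (UNIV :: nat set))"
    using nf' by (simp only: is_frame_def)
  have C: "C \<ge> 0" using L LC by linarith
  note norms = normalized_orbit_sum[OF S upper C]
  let ?g = "\<lambda>y x n. (cmod (cinner y ((A ^^ n) x)))\<^sup>2"
  let ?h = "\<lambda>y x n. ?g y x n / (norm ((A ^^ n) x))\<^sup>2"
  have gh: "B\<^sup>2 * ?h y x n \<le> ?g y x n \<and> ?g y x n \<le> D\<^sup>2 * ?h y x n" if "x \<in> S" for x y n
  proof -
    have "(norm ((A ^^ n) x))\<^sup>2 * ?h y x n = ?g y x n" using nonzero that by simp
    moreover have "B\<^sup>2 * ?h y x n \<le> (norm ((A ^^ n) x))\<^sup>2 * ?h y x n"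
      using bd that B0 by (intro mult_right_mono power_mono) auto
    moreover have "(norm ((A ^^ n) x))\<^sup>2 * ?h y x n \<le> D\<^sup>2 * ?h y x n"
      using bd that by (intro mult_right_mono power_mono) auto
    ultimately show ?thesis by linarith
  qed
  have summ: "summable (?g y x)" if "x \<in> S" for x y
    by (rule summable_comparison_test_ev[OF _ summable_mult[OF norms(1)[OF that], of "D\<^sup>2" y]])
      (use gh[OF that] in \<open>auto intro!: always_eventually\<close>)
  have eq: "frame_sum (S \<times> UNIV) (orbit A) y = ennreal (\<Sum>x\<in>S. \<Sum>n. ?g y x n)" for y
    using frame_sum_suminf[OF S, of y "orbit A"] summ by (simp add: orbit_def)
  have lo: "B\<^sup>2 * (\<Sum>x\<in>S. \<Sum>n. ?h y x n) \<le> (\<Sum>x\<in>S. \<Sum>n. ?g y x n)" for y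
    unfolding sum_distrib_left
  proof (rule sum_mono)
    fix x assume x: "x \<in> S"
    have "B\<^sup>2 * (\<Sum>n. ?h y x n) = (\<Sum>n. B\<^sup>2 * ?h y x n)"
      by (rule suminf_mult[symmetric, OF norms(1)[OF x]])
    also have "\<dots> \<le> (\<Sum>n. ?g y x n)"
      using gh[OF x] by (intro suminf_le summable_mult norms(1)[OF x] summ[OF x]) auto
    finally show "B\<^sup>2 * (\<Sum>n. ?h y x n) \<le> (\<Sum>n. ?g y x n)" .
  qed
  have hi: "(\<Sum>x\<in>S. \<Sum>n. ?g y x n) \<le> D\<^sup>2 * (\<Sum>x\<in>S. \<Sum>n. ?h y x n)" for y
    unfolding sum_distrib_left
  proof (rule sum_mono)
    fix x assume x: "x \<in> S"
    have "(\<Sum>n. ?g y x n) \<le> (\<Sum>n. D\<^sup>2 * ?h y x n)"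
      using gh[OF x] by (intro suminf_le summable_mult norms(1)[OF x] summ[OF x]) auto
    also have "\<dots> = D\<^sup>2 * (\<Sum>n. ?h y x n)"
      by (rule suminf_mult[OF norms(1)[OF x]])
    finally show "(\<Sum>n. ?g y x n) \<le> D\<^sup>2 * (\<Sum>n. ?h y x n)" .
  qed
  define L' where "L' = B\<^sup>2 * L"
  \<comment> \<open>The maximum gives \<open>L' \<le> C'\<close> at once, as \<open>is_frame\<close>
    demands.\<close>
  define C' where "C' = max L' (D\<^sup>2 * C)"
  have h0: "0 \<le> (\<Sum>x\<in>S. \<Sum>n. ?h y x n)" for y
    by (intro sum_nonneg suminf_nonneg norms(1)) auto
  have "ennreal (L' * (norm y)\<^sup>2) \<le> frame_sum (S \<times> UNIV) (orbit A) y" for y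
  proof -
    have "L * (norm y)\<^sup>2 \<le> (\<Sum>x\<in>S. \<Sum>n. ?h y x n)"
      using lower[of y] h0[of y] unfolding norms(3) by (simp only: ennreal_le_iff)
    then have "B\<^sup>2 * (L * (norm y)\<^sup>2) \<le> B\<^sup>2 * (\<Sum>x\<in>S. \<Sum>n. ?h y x n)"
      by (intro mult_left_mono) auto
    then show ?thesis using lo[of y] unfolding eq L'_def
      by (intro ennreal_leI) (simp add: mult.assoc)
  qed
  moreover have "frame_sum (S \<times> UNIV) (orbit A) y \<le> ennreal (C' * (norm y)\<^sup>2)" for y
  proof -
    have "D\<^sup>2 * (\<Sum>x\<in>S. \<Sum>n. ?h y x n) \<le> D\<^sup>2 * (C * (norm y)\<^sup>2)"
      by (intro mult_left_mono norms(2)) auto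
    also have "\<dots> \<le> C' * (norm y)\<^sup>2"
      unfolding C'_def mult.assoc[symmetric] by (intro mult_right_mono) auto
    finally show ?thesis using hi[of y] unfolding eq by (intro ennreal_leI) linarith
  qed
  moreover have "0 < L'" "L' \<le> C'" using B0 L by (simp_all add: L'_def C'_def)
  ultimately show ?thesis
    unfolding is_frame_def using countable by blast
qed

section \<open>The four conditions\<close>

theorem theorem5p7:
  fixes A :: "'a::chilbert_space \<Rightarrow> 'a" and S :: "'a set"
  assumes separable: "separable_space (euclidean :: 'a topology)"
    and normal: "normal_operator A"
    and S: "finite S" "S \<noteq> {}"
    and nonzero: "\<forall>x\<in>S. \<forall>n. (A ^^ n) x \<noteq> 0"
    and conditions:
      "is_frame UNIV (S \<times> UNIV) (orbit A)
       \<or> (\<exists>B C. 0 < B \<and> B \<le> C \<and> (\<forall>n. \<forall>x\<in>S. B \<le> norm ((A ^^ n) x) \<and> norm ((A ^^ n) x) \<le> C))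
       \<or> (onorm A = 1 \<and> (\<exists>w0. w0 \<noteq> 0 \<and> A w0 = w0 \<and> (\<forall>x\<in>S. cinner w0 x \<noteq> 0)))
       \<or> (onorm A < 1 \<and> (\<exists>M. complex_vector.subspace M \<and> closed M \<and> infinite_dimensional M
            \<and> lower_frame_condition M (S \<times> UNIV) (\<lambda>j. orth_proj M (orbit A j))))"
  shows "\<not> frame_normalizable UNIV (S \<times> UNIV) (orbit A)"
proof
  assume nf: "frame_normalizable UNIV (S \<times> UNIV) (orbit A)"
  then have "is_frame UNIV (S \<times> UNIV) (\<lambda>j. orbit A j /\<^sub>R norm (orbit A j))"
    by (simp only: frame_normalizable_def)
  then obtain L C where "0 < L" "L \<le> C"
    and upper: "\<And>y. frame_sum (S \<times> UNIV) (\<lambda>j. orbit A j /\<^sub>R norm (orbit A j)) y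
      \<le> ennreal (C * (norm y)\<^sup>2)"
    by (rule is_frameE) blast
  then have C: "C \<ge> 0" by linarith
  note norms = normalized_orbit_sum[OF S(1) upper C]
  have bl: "bounded_linear A" using normal by (simp add: normal_operator_def bounded_clinear_def)
  have norm_A: "norm (A x) \<le> onorm A * norm x" for x by (rule onorm[OF bl])
  from conditions show False
  proof (elim disjE exE conjE)
    assume "is_frame UNIV (S \<times> UNIV) (orbit A)"
    then show False using orbit_not_frame_and_normalizable[OF normal S nonzero] nf by blast
  next
    fix B D assume b: "0 < B" "\<forall>n. \<forall>x\<in>S. B \<le> norm ((A ^^ n) x) \<and> norm ((A ^^ n) x) \<le> D"
    have "is_frame UNIV (S \<times> UNIV) (orbit A)"
      by (rule orbit_frame_if_norm_bounded[OF S(1) nonzero b nf])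
    then show False using orbit_not_frame_and_normalizable[OF normal S nonzero] nf by blast
  next
    fix w assume c: "onorm A = 1" "A w = w" "\<forall>x\<in>S. cinner w x \<noteq> 0"
    obtain x where x: "x \<in> S" using S(2) by blast
    have x0: "x \<noteq> 0" using c(3) x by auto
    \<comment> \<open>The adjoint fixes \<open>w\<close> too, so the coefficients of
      \<open>w\<close> along the orbit never change.\<close>
    have adj: "cinner w ((A ^^ n) x) = cinner w x" for n
    proof -
      have "cinner ((cadjoint A ^^ n) w) x = cinner w ((A ^^ n) x)"
        by (rule cinner_adjoint_left[OF cinner_funpow_adjoint[OF cadjoint]])
          (use normal in \<open>simp add: normal_operator_def\<close>)
      moreover have "(cadjoint A ^^ n) w = w"
        by (induction n) (simp_all add: cadjoint_fixed_point[OF normal c(2)])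
      ultimately show ?thesis by simp
    qed
    have le: "norm ((A ^^ n) x) \<le> norm x" for n
    proof (induction n)
      case (Suc n)
      then show ?case using norm_A[of "(A ^^ n) x"] c(1) by simp
    qed simp
    \<comment> \<open>The term of the normalized series at \<open>n = 0\<close>. Later terms have
      the same numerator and, by \<open>le\<close>, no larger denominator, so they cannot tend to
      0.\<close>
    let ?k = "(cmod (cinner w x))\<^sup>2 / (norm x)\<^sup>2"
    have "?k \<le> (cmod (cinner w ((A ^^ n) x)))\<^sup>2 / (norm ((A ^^ n) x))\<^sup>2" for n
      unfolding adj using le[of n] nonzero x x0
      by (intro divide_left_mono power_mono mult_pos_pos zero_less_power) auto
    moreover have "(\<lambda>n. (cmod (cinner w ((A ^^ n) x)))\<^sup>2 / (norm ((A ^^ n) x))\<^sup>2) \<longlonglongrightarrow> 0"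
      by (rule summable_LIMSEQ_zero[OF norms(1)[OF x]])
    ultimately have "?k \<le> 0" by (intro LIMSEQ_le_const) auto
    moreover have "?k > 0" using c(3) x x0 by simp
    ultimately show False by linarith
  next
    fix M assume d: "onorm A < 1" "complex_vector.subspace M" "closed M" "infinite_dimensional M"
      "lower_frame_condition M (S \<times> UNIV) (\<lambda>j. orth_proj M (orbit A j))"
    have "summable (\<lambda>n. (norm (orth_proj M (orbit A (x, n))))\<^sup>2)" for x
    proof (rule summable_comparison_test_ev)
      show "summable (\<lambda>n. (norm ((A ^^ n) x))\<^sup>2)"
      proof (rule summable_if_contracting)
        \<comment> \<open>The contraction factor is squared to match squared norms, and a single
          application of \<open>A\<close> already contracts, so the shift is 1.\<close>
        show "(onorm A)\<^sup>2 < 1"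
          using d(1) onorm_pos_le[OF bl] by (simp add: power_less_one_iff)
        show "(norm ((A ^^ (n + 1)) x))\<^sup>2 \<le> (onorm A)\<^sup>2 * (norm ((A ^^ n) x))\<^sup>2" for n
          using power_mono[OF norm_A[of "(A ^^ n) x"], of 2] by (simp add: power_mult_distrib)
      qed simp
      show "\<forall>\<^sub>F n in sequentially.
          norm ((norm (orth_proj M (orbit A (x, n))))\<^sup>2) \<le> (norm ((A ^^ n) x))\<^sup>2"
        using norm_orth_proj_le[OF d(2,3)]
        by (auto simp: orbit_def intro!: always_eventually power_mono)
    qed
    then show False
      using lower_frame_square_summable_finite_dimensional[OF d(2) S(1) d(5)] d(4) by blast
  qed
qed

end
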